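(* Let $S\subset\mathbb{R}^2$ be a compact convex set with $0$ on its boundary, and let $\{y_i\}_{i\ge0}$ be a sequence generated by the algorithm described in the context. Then the convergence of $\{\|y_i\|\}_i$ to zero is at worst linear with constant $1/\sqrt2$; that is, there is a constant $M\ge0$ such that $\|y_i\|\le M\,(1/\sqrt2)^{\,i}$ for all $i$.
   Context: Algorithm: choose $y_0$ in the boundary of $S$ and set $i=0$. At iteration $i$, let $s_{i+1}$ be a minimizer of $\min_{s\in S} y_i^Ts$; let $C_{i+1}=\{y_0,s_1,\dots,s_{i+1}\}$ and let $y_{i+1}:=P_{\operatorname{conv}(C_{i+1})}(0)$, the Euclidean projection of $0$ onto the convex hull of $C_{i+1}$; then increase $i$ by one. The algorithm is run indefinitely, or until some $y_i=0$. $\|\cdot\|$ is the Euclidean norm. *)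

theory Defs
  imports "HOL-Analysis.Analysis" "HOL-Library.Extended_Nat"
begin

text \<open>The set \<open>C\<^sub>i = {y\<^sub>0, s\<^sub>1, \<dots>, s\<^sub>i}\<close>.\<close>

definition atoms :: "'a \<Rightarrow> (nat \<Rightarrow> 'a) \<Rightarrow> nat \<Rightarrow> 'a set" where
  "atoms y0 s i = insert y0 (s ` {1..i})"

definition iteration ::
  "'a::euclidean_space set \<Rightarrow> (nat \<Rightarrow> 'a) \<Rightarrow> (nat \<Rightarrow> 'a) \<Rightarrow> nat \<Rightarrow> bool" where
  "iteration S y s i \<longleftrightarrow>
     is_arg_min (\<lambda>x. inner (y i) x) (\<lambda>x. x \<in> S) (s (Suc i)) \<and>
     y (Suc i) = closest_point (convex hull (atoms (y 0) s (Suc i))) 0"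

text \<open>
  \<open>N\<close> is the number of iterations performed: either the algorithm is run indefinitely
  (\<open>N = \<infinity>\<close>), or it stops at the first iterate that vanishes (\<open>N = enat n\<close>), in which case the
  generated sequence is \<open>y\<^sub>0, \<dots>, y\<^sub>n\<close> and the values of \<open>y\<close> and \<open>s\<close> beyond \<open>n\<close> are
  unconstrained. An indefinite run is not required to avoid \<open>0\<close>. The value \<open>s 0\<close> is never used.
\<close>

definition generated_by_algorithm ::
  "'a::euclidean_space set \<Rightarrow> (nat \<Rightarrow> 'a) \<Rightarrow> (nat \<Rightarrow> 'a) \<Rightarrow> enat \<Rightarrow> bool" where
  "generated_by_algorithm S y s N \<longleftrightarrow>
     y 0 \<in> frontier S \<and>
     (\<forall>i. enat i < N \<longrightarrow> iteration S y s i) \<and>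
     (N = \<infinity> \<or> (\<exists>n. N = enat n \<and> y n = 0 \<and> (\<forall>i<n. y i \<noteq> 0)))"

end

theory Submission
  imports Defs
begin

text \<open>
  Once an iterate vanishes, \<open>0\<close> stays in the hull of the atoms and all later iterates
  vanish, so only a run without vanishing iterates needs an argument. Write \<open>v =
  y\<^sub>0\<close> and let \<open>e\<close> be orthogonal to \<open>v\<close>. Since
  \<open>v\<close> remains an atom, the line through \<open>y\<^sub>i\<close> perpendicular to
  \<open>y\<^sub>i\<close> always crosses the ray from \<open>0\<close> through \<open>v\<close>, at
  a point \<open>c\<^sub>i v\<close> with \<open>0 < c\<^sub>i \<le> 1\<close>
  (\<open>level\<close>). Seen with \<open>v\<close> as the vertical direction, the algorithm is a
  Newton or secant iteration on the lower boundary of \<open>S\<close>: for \<open>i > 0\<close>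
  that line carries a chord joining the newest atom \<open>s\<^sub>i\<close> to an older atom on or
  beyond the axis, the pivot; \<open>s\<^bsub>i+1\<^esub>\<close> is the point of \<open>S\<close>
  farthest below the chord, at vertical depth \<open>D\<^sub>i \<ge> c\<^sub>i\<close>
  (\<open>gap\<close>); and the next chord joins \<open>s\<^bsub>i+1\<^esub>\<close> to the end of
  the old chord on the opposite side of the axis. The induction steps \<open>chord_same_side\<close>
  and \<open>chord_opposite_side\<close> establish this picture.

  Let \<open>L\<close> be the horizontal width of the chord that carries
  \<open>y\<^bsub>i+1\<^esub>\<close>. Two quantities control the iterate:
  \<open>\<parallel>y\<^bsub>i+1\<^esub>\<parallel>\<^sup>2\<close> is at most
  \<open>\<parallel>v\<parallel>\<^sup>2 c\<^sub>i c\<^bsub>i+1\<^esub>\<close> and at most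
  \<open>D\<^sub>i L\<close> (\<open>norm_iterate_le_weight\<close>). Let \<open>c', D', L'\<close>
  denote the same quantities one step later. As a rule, neither of the two bounds increases in a
  step and one of them falls by a factor \<open>4\<close>. If the new atom lies on the same side of
  the axis as the previous one, the pivot is kept and the classical Newton estimate \<open>D'/D +
  L'/L \<le> 1\<close> gives \<open>D' L' \<le> D L / 4\<close> (\<open>weight_same_side\<close>).
  If it lies on the other side, the levels shrink by the factors \<open>a/(a+b)\<close> and
  \<open>b'/(a+b')\<close>, where \<open>a\<close>, \<open>b\<close>, \<open>b'\<close> are the
  distances of the previous atom, the pivot and the new atom from the axis; as \<open>b' \<le>
  b\<close>, their product is at most \<open>1/4\<close> (\<open>weight_opposite_side\<close>). So
  the \<open>weight\<close> \<open>c\<^sub>i c\<^bsub>i+1\<^esub> D\<^sub>i L\<close> loses a factor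
  \<open>4\<close> per step, and \<open>\<parallel>y\<^bsub>i+1\<^esub>\<parallel>\<^sup>4\<close>
  is at most \<open>\<parallel>v\<parallel>\<^sup>2\<close> times it, which gives the rate
  \<open>4\<^bsup>-1/4\<^esup> = 1/\<surd>2\<close>.

  The exception is the first change of side. The estimate \<open>b' \<le> b\<close> uses that
  \<open>S\<close> has a line of support at the pivot that is not vertical. An atom produced by the
  algorithm has one, but \<open>v\<close> need not. The pivot is \<open>v\<close> only until the
  first change of side. If there is no such change, every step is of the first kind; if there is
  one, the finitely many iterates before it only affect the constant \<open>M\<close>.
\<close>

section \<open>Plane geometry\<close>

text \<open>
  A vector \<open>e\<close> transversal to \<open>v\<close> is \<open>v\<close> turned by a right
  angle, in either orientation. Both are admitted so that the two sides of the axis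
  \<open>\<real>v\<close> can be exchanged by passing from \<open>e\<close> to \<open>-e\<close>.
\<close>

definition rot :: "real^2 \<Rightarrow> real^2" where
  "rot v = vector [- (v$2), v$1]"

definition transversal :: "real^2 \<Rightarrow> real^2 \<Rightarrow> bool" where
  "transversal v e \<longleftrightarrow> e = rot v \<or> e = - rot v"

text \<open>
  Parseval's identity for the orthogonal basis \<open>v, e\<close>, without denominators since
  \<open>e\<close> is as long as \<open>v\<close>.
\<close>

lemma transversal_inner:
  assumes "transversal v e"
  shows "(x \<bullet> w) * (v \<bullet> v) = (x \<bullet> v) * (w \<bullet> v) + (e \<bullet> x) * (e \<bullet> w)"
  using assms
  by (auto simp: transversal_def rot_def inner_vec_def sum_2 algebra_simps)

lemma transversal_orthogonal: "transversal v e \<Longrightarrow> e \<bullet> v = 0"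
  by (auto simp: transversal_def rot_def inner_vec_def sum_2 algebra_simps)

lemma transversal_uminus: "transversal v e \<Longrightarrow> transversal v (- e)"
  by (auto simp: transversal_def)

lemma transversal_parallel:
  assumes "transversal v e" "v \<noteq> 0" "e \<bullet> x = 0"
  shows "x = ((x \<bullet> v) / (v \<bullet> v)) *\<^sub>R v"
proof (rule vector_eq_ldot[THEN iffD1], rule allI)
  fix w
  have "(x \<bullet> w) * (v \<bullet> v) = (x \<bullet> v) * (w \<bullet> v)"
    using transversal_inner[OF assms(1), of x w] assms(3) by simp
  then show "w \<bullet> x = w \<bullet> (((x \<bullet> v) / (v \<bullet> v)) *\<^sub>R v)"
    using assms(2) by (simp add: inner_commute field_simps)
qed

text \<open>
  Normals scaled to agree at \<open>v\<close> behave like lines written as graphs over the direction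
  \<open>e\<close>: two of them differ by a change of slope \<open>\<mu>\<close> only.
\<close>

lemma normal_shift:
  assumes "transversal v e" "v \<noteq> 0" "n \<bullet> v = m \<bullet> v"
  obtains \<mu> where "\<And>x. m \<bullet> x = n \<bullet> x + \<mu> * (e \<bullet> x)"
proof
  fix x
  have "((m - n) \<bullet> x) * (v \<bullet> v) = (e \<bullet> (m - n)) * (e \<bullet> x)"
    using transversal_inner[OF assms(1), of "m - n" x] assms(3) by (simp add: inner_diff_left)
  then show "m \<bullet> x = n \<bullet> x + (e \<bullet> (m - n)) / (v \<bullet> v) * (e \<bullet> x)"
    using assms(2) by (simp add: inner_diff_left field_simps)
qed

lemma segment_crosses_axis:
  assumes "transversal v e" "v \<noteq> 0" "e \<bullet> P \<le> 0" "0 < e \<bullet> s"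
  defines "L \<equiv> e \<bullet> s - e \<bullet> P"
  obtains k where "k *\<^sub>R v = (e \<bullet> s / L) *\<^sub>R P + (- (e \<bullet> P) / L) *\<^sub>R s"
    "k *\<^sub>R v \<in> closed_segment P s"
proof -
  let ?x = "(e \<bullet> s / L) *\<^sub>R P + (- (e \<bullet> P) / L) *\<^sub>R s"
  have L: "L > 0" using assms by simp
  have "e \<bullet> ?x = 0" by (simp add: inner_add_right inner_diff_right)
  then obtain k where k: "?x = k *\<^sub>R v"
    using transversal_parallel[OF assms(1,2)] by blast
  have sum1: "1 - (- (e \<bullet> P) / L) = e \<bullet> s / L" using L by (simp add: L_def field_simps)
  have "- (e \<bullet> P) / L \<le> 1" "0 \<le> - (e \<bullet> P) / L"
    using L assms(3,4) by (auto simp: L_def field_simps)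
  then have "?x \<in> closed_segment P s"
    unfolding in_segment using sum1 by metis
  then show thesis using that k by metis
qed

lemma obtuse_segment_foot:
  fixes P s :: "'a::real_inner"
  assumes "P \<bullet> s \<le> 0" "P \<noteq> s"
  obtains z where "z \<in> closed_segment P s" "z \<bullet> P = z \<bullet> z" "z \<bullet> s = z \<bullet> z"
proof -
  define d where "d = (P - s) \<bullet> (P - s)"
  define t where "t = (P \<bullet> (P - s)) / d"
  define z where "z = (1 - t) *\<^sub>R P + t *\<^sub>R s"
  have d: "d > 0" using assms(2) by (simp add: d_def)
  have "0 \<le> P \<bullet> (P - s)" "P \<bullet> (P - s) \<le> d"
    using assms(1) inner_ge_zero[of P] inner_ge_zero[of s] inner_commute[of s P]
    by (auto simp: d_def inner_diff_left inner_diff_right simp del: inner_ge_zero)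
  then have "0 \<le> t" "t \<le> 1" using d by (auto simp: t_def)
  then have zs: "z \<in> closed_segment P s" unfolding in_segment z_def by blast
  have "z = P - t *\<^sub>R (P - s)" by (simp add: z_def algebra_simps)
  then have "z \<bullet> (P - s) = P \<bullet> (P - s) - t * d"
    by (simp add: d_def inner_diff_left)
  then have o: "z \<bullet> (P - s) = 0" using d by (simp add: t_def)
  have eq: "z \<bullet> P = z \<bullet> s" using o by (simp add: inner_diff_right)
  have "z \<bullet> z = (1 - t) * (z \<bullet> P) + t * (z \<bullet> s)"
    by (subst (2) z_def) (simp add: inner_add_right)
  then have "z \<bullet> z = z \<bullet> P" using eq by (simp add: algebra_simps)
  then show thesis using that zs eq by simp
qed

lemma zero_in_opposite_segment:
  fixes v :: "'a::real_vector"
  assumes "k \<le> 0"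
  shows "0 \<in> closed_segment (k *\<^sub>R v) v"
proof -
  have "(1 - (- k) / (1 - k)) * k + (- k) / (1 - k) = 0" using assms by (simp add: field_simps)
  then have "0 = (1 - (- k) / (1 - k)) *\<^sub>R (k *\<^sub>R v) + ((- k) / (1 - k)) *\<^sub>R v"
    by (metis scaleR_add_left scaleR_scaleR scaleR_zero_left)
  moreover have "0 \<le> (- k) / (1 - k)" "(- k) / (1 - k) \<le> 1" using assms by (auto simp: field_simps)
  ultimately show ?thesis unfolding in_segment by blast
qed

text \<open>
  A crossing at or beyond \<open>0\<close> would put \<open>0\<close> between the crossing point and
  \<open>v\<close>, hence in the triangle.
\<close>

lemma axis_crossing_positive:
  assumes "transversal v e" "v \<noteq> 0" "e \<bullet> P \<le> 0" "0 < e \<bullet> s"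
    and no0: "0 \<notin> convex hull {v, P, s}"
  defines "L \<equiv> e \<bullet> s - e \<bullet> P"
  obtains k where "0 < k" "k *\<^sub>R v = (e \<bullet> s / L) *\<^sub>R P + (- (e \<bullet> P) / L) *\<^sub>R s"
    "k *\<^sub>R v \<in> closed_segment P s"
proof -
  let ?H = "convex hull {v, P, s}"
  obtain k where k: "k *\<^sub>R v = (e \<bullet> s / L) *\<^sub>R P + (- (e \<bullet> P) / L) *\<^sub>R s"
      "k *\<^sub>R v \<in> closed_segment P s"
    using segment_crosses_axis[OF assms(1-4)] unfolding L_def by blast
  have "closed_segment P s \<subseteq> ?H"
    by (intro closed_segment_subset) (auto intro: hull_inc)
  then have kH: "k *\<^sub>R v \<in> ?H" using k by auto
  have "0 < k"
  proof (rule ccontr)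
    assume "\<not> 0 < k"
    then have nk: "k \<le> 0" by simp
    have "closed_segment (k *\<^sub>R v) v \<subseteq> ?H"
      using kH by (intro closed_segment_subset) (auto intro: hull_inc)
    then show False using no0 zero_in_opposite_segment[OF nk, of v] by auto
  qed
  then show thesis using that k by blast
qed

lemma closest_point_zero_eqI:
  fixes z :: "'a::euclidean_space"
  assumes "finite A" "z \<in> convex hull A" "\<And>x. x \<in> A \<Longrightarrow> z \<bullet> z \<le> z \<bullet> x"
  shows "closest_point (convex hull A) 0 = z"
proof (rule closest_point_unique[symmetric])
  show "\<forall>w\<in>convex hull A. dist 0 z \<le> dist 0 w"
  proof
    fix w assume w: "w \<in> convex hull A"
    have "convex hull A \<subseteq> {x. z \<bullet> z \<le> z \<bullet> x}"
      using assms(3) convex_halfspace_ge[of "z \<bullet> z" z] by (intro hull_minimal) auto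
    then have "z \<bullet> z \<le> z \<bullet> w" using w by auto
    also have "\<dots> \<le> norm z * norm w" by (rule norm_cauchy_schwarz)
    finally have "norm z * norm z \<le> norm z * norm w" by (simp add: dot_square_norm power2_eq_square)
    then show "dist 0 z \<le> dist 0 w" by (cases "z = 0") auto
  qed
qed (use assms in \<open>auto simp: finite_imp_compact_convex_hull compact_imp_closed\<close>)

text \<open>
  The geometric core of one iteration. The foot \<open>z\<close> of the perpendicular from
  \<open>0\<close> to the new chord lies on the chord because the angle at \<open>0\<close> is not
  acute. It is the projection onto the new hull because all atoms lie above the new chord: those on
  the side of \<open>s\<close> as seen from \<open>P\<close> lie above the old chord, and the new
  one is lower there; those beyond \<open>P\<close> lie above the line of support at
  \<open>P\<close>, and this line is above the new chord beyond \<open>P\<close> because it is not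
  above \<open>s\<close> on the other side. If the pivot is \<open>v\<close>, there are no atoms
  beyond it.
\<close>

lemma chord_turns:
  assumes e: "transversal v e" "v \<noteq> 0" and A: "finite A" "v \<in> A" "P \<in> A"
    and y: "0 < y \<bullet> y" "\<And>x. x \<in> A \<Longrightarrow> y \<bullet> y \<le> y \<bullet> x" "y \<bullet> P = y \<bullet> y" "y \<bullet> s \<le> 0"
    and sides: "e \<bullet> P \<le> 0" "0 < e \<bullet> s" and obtuse: "P \<bullet> s \<le> 0"
    and pivot: "P = v \<and> (\<forall>x\<in>A. 0 \<le> e \<bullet> x) \<or> (\<exists>n. 0 < n \<bullet> v \<and> (\<forall>x\<in>insert s A. n \<bullet> P \<le> n \<bullet> x))"
    and y': "y' = closest_point (convex hull (insert s A)) 0" "y' \<noteq> 0"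
  shows "y' \<in> closed_segment P s" "y' \<bullet> P = y' \<bullet> y'" "y' \<bullet> s = y' \<bullet> y'"
proof -
  let ?H = "convex hull (insert s A)"
  have Ps: "P \<noteq> s" using sides by auto
  then obtain z where z: "z \<in> closed_segment P s" "z \<bullet> P = z \<bullet> z" "z \<bullet> s = z \<bullet> z"
    using obtuse_segment_foot[OF obtuse] by blast
  have segH: "closed_segment P s \<subseteq> ?H"
    using A by (intro closed_segment_subset) (auto intro: hull_inc)
  have no0: "0 \<notin> ?H"
    using y' closest_point_self[of 0 ?H] by auto
  have "convex hull {v, P, s} \<subseteq> ?H" using A by (intro hull_mono) auto
  then obtain k where kpos: "k > 0" and k: "k *\<^sub>R v \<in> closed_segment P s"
    using axis_crossing_positive[OF e sides] no0 by blast
  have zz: "z \<bullet> z > 0" using z(1) segH no0 by auto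
  obtain u where u: "k *\<^sub>R v = (1 - u) *\<^sub>R P + u *\<^sub>R s" using k unfolding in_segment by blast
  have "z \<bullet> (k *\<^sub>R v) = z \<bullet> z"
    unfolding u using z(2,3) by (simp add: inner_add_right algebra_simps)
  then have zv: "z \<bullet> v > 0" using zz kpos by (metis inner_scaleR_right zero_less_mult_pos)
  have yv: "y \<bullet> v > 0" using y(1) y(2)[OF A(2)] by linarith
  \<comment> \<open>Scaled normals of the old and the new line; turning around \<open>P\<close> by \<open>\<mu> > 0\<close> lowers the line on the side of \<open>s\<close>.\<close>
  define n where "n = y /\<^sub>R (y \<bullet> v)"
  define m where "m = z /\<^sub>R (z \<bullet> v)"
  have nv: "n \<bullet> v = 1" "m \<bullet> v = 1" using yv zv by (auto simp: n_def m_def)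
  obtain \<mu> where \<mu>: "\<And>x. m \<bullet> x = n \<bullet> x + \<mu> * (e \<bullet> x)"
    using normal_shift[OF e, of n m] nv by auto
  have mPs: "m \<bullet> P = m \<bullet> s" using z by (simp add: m_def)
  have "n \<bullet> s \<le> 0" using y(4) yv by (simp add: n_def divide_nonpos_pos mult_nonneg_nonpos)
  moreover have "n \<bullet> P > 0" using y(1,3) yv by (simp add: n_def)
  ultimately have "\<mu> * (e \<bullet> s - e \<bullet> P) > 0" using mPs \<mu>[of P] \<mu>[of s] by (simp add: algebra_simps)
  then have \<mu>pos: "\<mu> > 0" using sides by (simp add: zero_less_mult_iff)
  have mx: "m \<bullet> P \<le> m \<bullet> x" if "x \<in> A" for x
  proof (cases "e \<bullet> P \<le> e \<bullet> x")
    case True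
    have "n \<bullet> P \<le> n \<bullet> x" using y(2)[OF that] y(3) yv by (simp add: n_def divide_right_mono)
    then show ?thesis using \<mu>[of P] \<mu>[of x] \<mu>pos True by (simp add: add_mono)
  next
    case False
    then have "\<not> (P = v \<and> (\<forall>x\<in>A. 0 \<le> e \<bullet> x))" using that sides by fastforce
    then obtain h where h: "0 < h \<bullet> v" "\<forall>x\<in>insert s A. h \<bullet> P \<le> h \<bullet> x" using pivot by blast
    \<comment> \<open>The scaled normal of the line of support at \<open>P\<close>.\<close>
    define l where "l = h /\<^sub>R (h \<bullet> v)"
    have lv: "l \<bullet> v = 1" using h by (simp add: l_def)
    have l: "l \<bullet> P \<le> l \<bullet> x" if "x \<in> insert s A" for x
      using h(1) h(2)[rule_format, OF that] by (simp add: l_def divide_right_mono)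
    obtain \<nu> where \<nu>: "\<And>x. l \<bullet> x = m \<bullet> x + \<nu> * (e \<bullet> x)"
      using normal_shift[OF e, of m l] nv lv by auto
    have "0 \<le> \<nu> * (e \<bullet> s - e \<bullet> P)" using l[of s] \<nu>[of s] \<nu>[of P] mPs by (simp add: algebra_simps)
    then have "0 \<le> \<nu>" using sides by (simp add: zero_le_mult_iff)
    then have "\<nu> * (e \<bullet> x) \<le> \<nu> * (e \<bullet> P)" using False by (simp add: mult_left_mono)
    then show ?thesis using l[of x] that \<nu>[of x] \<nu>[of P] by auto
  qed
  have "z \<bullet> z \<le> z \<bullet> x" if "x \<in> insert s A" for x
  proof -
    have "m \<bullet> P \<le> m \<bullet> x" using that mx mPs by auto
    then have "z \<bullet> P \<le> z \<bullet> x" using zv by (simp add: m_def divide_le_cancel)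
    then show ?thesis using z by simp
  qed
  then have "y' = z" unfolding y'(1)
    using A z(1) segH by (intro closest_point_zero_eqI) auto
  then show "y' \<in> closed_segment P s" "y' \<bullet> P = y' \<bullet> y'" "y' \<bullet> s = y' \<bullet> y'" using z by auto
qed

text \<open>
  Why the new chord \<open>P s\<close> is seen from \<open>0\<close> under an angle that is not
  acute, when the old chord \<open>P Q\<close> was. Write the crossing \<open>k v\<close> with the
  axis as a convex combination of \<open>P\<close> (weight \<open>\<lambda>\<close>) and
  \<open>s\<close>. Testing with \<open>y\<close> gives \<open>k \<le> \<lambda>c\<close>, where
  \<open>c v\<close> is the crossing of the old chord; testing with \<open>P\<close> turns this into
  a bound on \<open>P \<bullet> s\<close>, because \<open>P \<bullet> (c v) \<le> P \<bullet>
  P\<close>.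
\<close>

lemma obtuse_at_tangent_pivot:
  assumes e: "transversal v e" "v \<noteq> 0"
    and y: "0 < y \<bullet> y" "0 < y \<bullet> v" "y \<bullet> P = y \<bullet> y" "y \<bullet> Q = y \<bullet> y" "y \<bullet> s \<le> 0"
    and no0: "0 \<notin> convex hull {v, P, s}"
    and PQ: "P \<bullet> Q \<le> 0" and sides: "e \<bullet> P < 0" "0 \<le> e \<bullet> Q" "0 < e \<bullet> s"
  shows "P \<bullet> s \<le> 0"
proof -
  define L where "L = e \<bullet> s - e \<bullet> P"
  have L: "L > 0" using sides by (simp add: L_def)
  obtain k where kpos: "k > 0" and k: "k *\<^sub>R v = (e \<bullet> s / L) *\<^sub>R P + (- (e \<bullet> P) / L) *\<^sub>R s"
    using axis_crossing_positive[OF e less_imp_le[OF sides(1)] sides(3) no0] unfolding L_def by blast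
  \<comment> \<open>The point \<open>Q\<close> may lie on the axis, so the segment is traversed from \<open>Q\<close> to \<open>P\<close> with \<open>-e\<close>.\<close>
  have "- e \<bullet> Q \<le> 0" "0 < - e \<bullet> P" using sides by simp_all
  then obtain c where c: "c *\<^sub>R v \<in> closed_segment P Q"
    using segment_crosses_axis[OF transversal_uminus[OF e(1)] e(2), of Q P]
    by (metis closed_segment_commute)
  then obtain t where t: "0 \<le> t" "t \<le> 1" "c *\<^sub>R v = (1 - t) *\<^sub>R P + t *\<^sub>R Q"
    unfolding in_segment by blast
  have "c * (y \<bullet> v) = y \<bullet> y"
    using arg_cong[OF t(3), of "\<lambda>x. y \<bullet> x"] y(3,4) by (simp add: inner_add_right algebra_simps)
  moreover have "k * (y \<bullet> v) = (e \<bullet> s / L) * (y \<bullet> y) + (- (e \<bullet> P) / L) * (y \<bullet> s)"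
    using arg_cong[OF k, of "\<lambda>x. y \<bullet> x"] y(3) by (simp add: inner_add_right inner_diff_right)
  moreover have "(- (e \<bullet> P) / L) * (y \<bullet> s) \<le> 0"
    using sides L y by (intro mult_nonneg_nonpos) (auto simp: divide_nonpos_pos)
  ultimately have "k * (y \<bullet> v) \<le> (e \<bullet> s / L) * c * (y \<bullet> v)"
    by (metis add_le_same_cancel1 mult.assoc)
  then have kc: "k \<le> (e \<bullet> s / L) * c" using y(2) by (rule mult_right_le_imp_le)
  have "c * (P \<bullet> v) = (1 - t) * (P \<bullet> P) + t * (P \<bullet> Q)"
    using arg_cong[OF t(3), of "\<lambda>x. P \<bullet> x"] by (simp add: inner_add_right)
  also have "\<dots> \<le> 1 * (P \<bullet> P) + 0"
    using t PQ by (intro add_mono mult_right_mono) (auto simp: mult_nonneg_nonpos)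
  finally have cP: "c * (P \<bullet> v) \<le> P \<bullet> P" by simp
  have ld: "e \<bullet> s / L \<ge> 0" using L sides by simp
  have kP: "k * (P \<bullet> v) \<le> (e \<bullet> s / L) * (P \<bullet> P)"
  proof (cases "P \<bullet> v \<ge> 0")
    case True
    then have "k * (P \<bullet> v) \<le> (e \<bullet> s / L) * c * (P \<bullet> v)" using kc by (intro mult_right_mono)
    also have "\<dots> \<le> (e \<bullet> s / L) * (P \<bullet> P)" using mult_left_mono[OF cP ld] by (simp only: mult.assoc)
    finally show ?thesis .
  next
    case False
    then have "k * (P \<bullet> v) \<le> 0" using kpos by (simp add: mult_nonneg_nonpos)
    also have "\<dots> \<le> (e \<bullet> s / L) * (P \<bullet> P)" using ld by (intro mult_nonneg_nonneg) auto
    finally show ?thesis .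
  qed
  have "k * (P \<bullet> v) = (e \<bullet> s / L) * (P \<bullet> P) + (- (e \<bullet> P) / L) * (P \<bullet> s)"
    using arg_cong[OF k, of "\<lambda>x. P \<bullet> x"] by (simp add: inner_add_right inner_diff_right)
  with kP have "(- (e \<bullet> P) / L) * (P \<bullet> s) \<le> 0" by simp
  moreover have "- (e \<bullet> P) / L > 0" using sides L by (simp add: divide_neg_pos)
  ultimately show ?thesis by (meson mult_pos_pos not_le)
qed


text \<open>
  The same for the pivot \<open>v\<close>, which lies on the axis, so that the convex combination
  degenerates to \<open>v\<close>. Here \<open>y\<close> and \<open>s\<close> are on one side of the
  axis, and \<open>y \<bullet> s \<le> 0\<close> forces \<open>s\<close> to point away from
  \<open>v\<close>.
\<close>

lemma obtuse_at_start:
  assumes e: "transversal v e" and y: "0 < y \<bullet> v" "y \<bullet> s \<le> 0"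
    and sides: "0 \<le> e \<bullet> y" "0 \<le> e \<bullet> s"
  shows "v \<bullet> s \<le> 0"
proof -
  have "(y \<bullet> s) * (v \<bullet> v) \<le> 0" using y by (simp add: mult_nonpos_nonneg)
  moreover have "0 \<le> (e \<bullet> y) * (e \<bullet> s)" using sides by simp
  ultimately have "(y \<bullet> v) * (s \<bullet> v) \<le> 0"
    using transversal_inner[OF e, of y s] by linarith
  then show ?thesis using y by (simp add: mult_le_0_iff inner_commute)
qed

text \<open>
  Let \<open>z\<close> be the foot of the perpendicular on the line \<open>P s\<close> and \<open>c
  v\<close> the crossing with the axis. The area of the triangle \<open>0, P, s\<close> computed
  with \<open>z\<close> as height and with \<open>c v\<close> as common base gives
  \<open>\<parallel>z\<parallel> \<parallel>s - P\<parallel> = c (e \<bullet> s - e \<bullet>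
  P)\<close>. The claim follows from \<open>\<parallel>c v\<parallel> \<le> \<parallel>s -
  P\<parallel>\<close>: the crossing lies on the segment, and the segment is at least as long as its
  ends are far from \<open>0\<close>, the angle not being acute.
\<close>

lemma foot_width:
  assumes e: "transversal v e" "v \<noteq> 0"
    and z: "z \<bullet> P = z \<bullet> z" "z \<bullet> s = z \<bullet> z" "0 < z \<bullet> v"
    and sides: "e \<bullet> P \<le> 0" "0 < e \<bullet> s" and obtuse: "P \<bullet> s \<le> 0"
  shows "(v \<bullet> v) * (z \<bullet> z) \<le> (e \<bullet> s - e \<bullet> P)\<^sup>2"
proof -
  define d where "d = s - P"
  define c where "c = (z \<bullet> z) / (z \<bullet> v)"
  have V: "v \<bullet> v > 0" using e by simp
  have Z: "z \<bullet> z > 0" using z(3) by auto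
  have cpos: "c > 0" using Z z by (simp add: c_def)
  have cz: "c * (z \<bullet> v) = z \<bullet> z" using z by (simp add: c_def)
  obtain k where k: "k *\<^sub>R v \<in> closed_segment P s"
    using segment_crosses_axis[OF e sides] by blast
  then obtain u where u: "0 \<le> u" "u \<le> 1" "k *\<^sub>R v = (1 - u) *\<^sub>R P + u *\<^sub>R s"
    unfolding in_segment by blast
  have "k * (z \<bullet> v) = z \<bullet> z"
    using arg_cong[OF u(3), of "\<lambda>x. z \<bullet> x"] z by (simp add: inner_add_right algebra_simps)
  then have kc: "k = c" using cz z(3) by (metis less_irrefl mult_right_cancel)
  have "c\<^sup>2 * (v \<bullet> v) = (k *\<^sub>R v) \<bullet> (k *\<^sub>R v)" by (simp add: kc power2_eq_square)
  also have "\<dots> = (1-u)\<^sup>2 * (P \<bullet> P) + u\<^sup>2 * (s \<bullet> s) + 2 * (u * (1 - u)) * (P \<bullet> s)"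
    unfolding u(3) by (simp add: inner_add_left inner_add_right inner_commute power2_eq_square algebra_simps)
  also have "\<dots> \<le> 1 * (P \<bullet> P) + 1 * (s \<bullet> s) + 0"
    using u obtuse by (intro add_mono mult_right_mono mult_nonneg_nonpos) (auto simp: power_le_one)
  also have "\<dots> \<le> d \<bullet> d"
    using obtuse by (simp add: d_def inner_diff_left inner_diff_right inner_commute)
  finally have cd: "c\<^sup>2 * (v \<bullet> v) \<le> d \<bullet> d" .
  have zd: "z \<bullet> d = 0" using z by (simp add: d_def inner_diff_right)
  \<comment> \<open>The identity \<open>c\<^sup>2 (e \<bullet> d)\<^sup>2 = (d \<bullet> d) (z \<bullet> z)\<close> follows from Parseval for \<open>d\<close>, \<open>z\<close> and \<open>d \<bullet> z = 0\<close>.\<close>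
  have h: "(d \<bullet> v) * (z \<bullet> v) + (e \<bullet> d) * (e \<bullet> z) = 0"
    using transversal_inner[OF e(1), of d z] zd by (simp add: inner_commute)
  have h2: "(d \<bullet> v)\<^sup>2 * (z \<bullet> v)\<^sup>2 = (e \<bullet> d)\<^sup>2 * (e \<bullet> z)\<^sup>2"
  proof -
    have "(d \<bullet> v) * (z \<bullet> v) = - ((e \<bullet> d) * (e \<bullet> z))" using h by simp
    then show ?thesis by (metis power2_minus power_mult_distrib)
  qed
  have "(e \<bullet> d)\<^sup>2 * ((z \<bullet> z) * (v \<bullet> v)) = (d \<bullet> d) * (v \<bullet> v) * (z \<bullet> v)\<^sup>2"
    unfolding transversal_inner[OF e(1)] using h2 by (simp add: power2_eq_square algebra_simps)
  then have "(e \<bullet> d)\<^sup>2 * (z \<bullet> z) = (d \<bullet> d) * (z \<bullet> v)\<^sup>2" using V by simp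
  also have "\<dots> \<ge> c\<^sup>2 * (v \<bullet> v) * (z \<bullet> v)\<^sup>2" using cd by (intro mult_right_mono) auto
  also have "c\<^sup>2 * (v \<bullet> v) * (z \<bullet> v)\<^sup>2 = (v \<bullet> v) * (z \<bullet> z) * (z \<bullet> z)"
    unfolding cz[symmetric] by (simp add: power2_eq_square)
  finally have "(v \<bullet> v) * (z \<bullet> z) \<le> (e \<bullet> d)\<^sup>2" using Z by (simp add: mult_le_cancel_right)
  then show ?thesis by (simp add: d_def inner_diff_right)
qed

section \<open>The chord through an iterate\<close>

locale nonvanishing_run =
  fixes S :: "(real^2) set" and y s :: "nat \<Rightarrow> real^2"
  assumes zero_mem: "0 \<in> S" and start_mem: "y 0 \<in> S"
    and iter: "\<And>i. iteration S y s i" and nonzero: "\<And>i. y i \<noteq> 0"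
begin

abbreviation v :: "real^2" where "v \<equiv> y 0"
abbreviation C :: "nat \<Rightarrow> (real^2) set" where "C \<equiv> atoms v s"

lemma new_atom_mem: "s (Suc i) \<in> S"
  and new_atom_minimal: "x \<in> S \<Longrightarrow> y i \<bullet> s (Suc i) \<le> y i \<bullet> x"
  using iter[of i] by (auto simp: iteration_def is_arg_min_def not_less)

lemma new_atom_nonpos: "y i \<bullet> s (Suc i) \<le> 0"
  using new_atom_minimal[OF zero_mem, of i] by simp

lemma C_Suc: "C (Suc i) = insert (s (Suc i)) (C i)"
  by (auto simp: atoms_def atLeastAtMostSuc_conv)

lemma finite_C: "finite (C i)" by (simp add: atoms_def)

lemma v_in_C: "v \<in> C i" by (simp add: atoms_def)

lemma C_subset: "C i \<subseteq> S"
proof (induction i)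
  case 0
  show ?case by (simp add: atoms_def start_mem)
next
  case (Suc i)
  then show ?case by (simp add: C_Suc new_atom_mem)
qed

lemma iterate_Suc: "y (Suc i) = closest_point (convex hull (C (Suc i))) 0"
  using iter by (simp add: iteration_def)

lemma zero_notin_hull: "0 \<notin> convex hull (C (Suc i))"
  using nonzero[of "Suc i"] closest_point_self[of 0 "convex hull (C (Suc i))"] iterate_Suc[of i] by auto

lemma inner_self_pos: "0 < y i \<bullet> y i"
  using nonzero by simp

lemma iterate_supports:
  assumes "x \<in> C i"
  shows "y i \<bullet> y i \<le> y i \<bullet> x"
proof (cases i)
  case 0
  then show ?thesis using assms by (simp add: atoms_def)
next
  case (Suc j)
  have "(0 - y i) \<bullet> (x - y i) \<le> 0"
    unfolding Suc iterate_Suc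
    by (intro closest_point_dot)
      (use assms Suc finite_C in \<open>auto simp: finite_imp_compact_convex_hull compact_imp_closed hull_inc\<close>)
  then show ?thesis by (simp add: inner_diff_right)
qed

lemma iterate_v_pos: "0 < y i \<bullet> v"
  using iterate_supports[OF v_in_C, of i] inner_self_pos[of i] by linarith

text \<open>
  A minimizer on the axis would be a nonpositive multiple of \<open>v\<close>, and the next iterate
  would vanish.
\<close>

lemma new_atom_off_axis:
  assumes "transversal v e"
  shows "e \<bullet> s (Suc i) \<noteq> 0"
proof
  assume "e \<bullet> s (Suc i) = 0"
  then obtain k where k: "s (Suc i) = k *\<^sub>R v"
    using transversal_parallel[OF assms nonzero] by blast
  then have "k * (y i \<bullet> v) \<le> 0" using new_atom_nonpos[of i] by simp
  then have "k \<le> 0" using iterate_v_pos[of i] by (simp add: mult_le_0_iff)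
  then have "0 \<in> closed_segment (s (Suc i)) v" using zero_in_opposite_segment k by metis
  moreover have "closed_segment (s (Suc i)) v \<subseteq> convex hull (C (Suc i))"
    by (intro closed_segment_subset) (auto intro!: hull_inc simp: v_in_C C_Suc)
  ultimately show False using zero_notin_hull by blast
qed

text \<open>
  The iterate \<open>y\<^bsub>i+1\<^esub>\<close> is the foot of the perpendicular on the chord from
  the pivot \<open>p\<close> to the newest atom \<open>s\<^bsub>i+1\<^esub>\<close>. The pivot also
  lies on the line of \<open>y\<^sub>i\<close>, so the line has turned around \<open>p\<close>. The
  orientation of \<open>e\<close> is part of the state and is chosen so that the newest atom is on
  the positive side.
\<close>

definition chord :: "nat \<Rightarrow> real^2 \<Rightarrow> real^2 \<Rightarrow> bool" where
  "chord i e p \<longleftrightarrow> transversal v e \<and> p \<in> C i \<and> e \<bullet> p \<le> 0 \<and> 0 < e \<bullet> s (Suc i)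
     \<and> y i \<bullet> p = y i \<bullet> y i \<and> p \<bullet> s (Suc i) \<le> 0
     \<and> y (Suc i) \<in> closed_segment p (s (Suc i))
     \<and> y (Suc i) \<bullet> p = y (Suc i) \<bullet> y (Suc i)
     \<and> y (Suc i) \<bullet> s (Suc i) = y (Suc i) \<bullet> y (Suc i)"

text \<open>
  The two reasons why no atom lies below a chord beyond its pivot. As long as all new atoms fall on
  one side of the axis the pivot is \<open>v\<close>, with nothing beyond it; afterwards the pivot
  is an earlier atom and \<open>S\<close> has a line of support there that is not parallel to
  \<open>v\<close>.
\<close>

definition start_pivot :: "nat \<Rightarrow> real^2 \<Rightarrow> real^2 \<Rightarrow> bool" where
  "start_pivot i e p \<longleftrightarrow> p = v \<and> (\<forall>x\<in>C i. 0 \<le> e \<bullet> x)"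

definition tangent_pivot :: "real^2 \<Rightarrow> real^2 \<Rightarrow> bool" where
  "tangent_pivot e p \<longleftrightarrow> e \<bullet> p < 0 \<and> (\<exists>n. 0 < n \<bullet> v \<and> (\<forall>x\<in>S. n \<bullet> p \<le> n \<bullet> x))"

lemma chordI:
  assumes e: "transversal v e" and p: "p \<in> C i" "y i \<bullet> p = y i \<bullet> y i"
    and sides: "e \<bullet> p \<le> 0" "0 < e \<bullet> s (Suc i)" and obtuse: "p \<bullet> s (Suc i) \<le> 0"
    and pivot: "start_pivot i e p \<or> tangent_pivot e p"
  shows "chord i e p"
proof -
  have "p = v \<and> (\<forall>x\<in>C i. 0 \<le> e \<bullet> x)
      \<or> (\<exists>n. 0 < n \<bullet> v \<and> (\<forall>x\<in>insert (s (Suc i)) (C i). n \<bullet> p \<le> n \<bullet> x))"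
    using pivot C_subset[of i] new_atom_mem[of i] unfolding start_pivot_def tangent_pivot_def by blast
  note turn = chord_turns[OF e nonzero finite_C v_in_C p(1) inner_self_pos iterate_supports p(2)
      new_atom_nonpos sides obtuse this, of "y (Suc i)"]
  show ?thesis
    unfolding chord_def using e p sides obtuse turn iterate_Suc[of i] nonzero[of "Suc i"]
    by (simp add: C_Suc)
qed

lemma chord_first: obtains e where "chord 0 e v" "start_pivot (Suc 0) e v"
proof -
  have r: "transversal v (rot v)" by (simp add: transversal_def)
  obtain e where e: "transversal v e" "0 < e \<bullet> s (Suc 0)"
  proof (cases "0 < rot v \<bullet> s (Suc 0)")
    case True
    then show thesis using that r by blast
  next
    case False
    then have "0 < - rot v \<bullet> s (Suc 0)" using new_atom_off_axis[OF r, of 0] by simp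
    then show thesis using that transversal_uminus[OF r] by blast
  qed
  have ev: "e \<bullet> v = 0" using transversal_orthogonal[OF e(1)] .
  then have "start_pivot 0 e v" by (simp add: start_pivot_def atoms_def)
  then have "chord 0 e v"
    using e ev new_atom_nonpos[of 0] by (intro chordI) (auto simp: v_in_C)
  moreover have "start_pivot (Suc 0) e v" using e ev by (simp add: start_pivot_def atoms_def)
  ultimately show thesis using that by blast
qed

lemma chord_same_side:
  assumes c: "chord i e p" and pivot: "start_pivot (Suc i) e p \<or> tangent_pivot e p"
    and side: "0 < e \<bullet> s (Suc (Suc i))"
  shows "chord (Suc i) e p" "start_pivot (Suc i) e p \<Longrightarrow> start_pivot (Suc (Suc i)) e p"
proof -
  note c' = c[unfolded chord_def]
  have hull: "0 \<notin> convex hull {v, p, s (Suc (Suc i))}"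
  proof -
    have "convex hull {v, p, s (Suc (Suc i))} \<subseteq> convex hull (C (Suc (Suc i)))"
      using c' v_in_C by (intro hull_mono) (auto simp: C_Suc)
    then show ?thesis using zero_notin_hull by blast
  qed
  have "p \<bullet> s (Suc (Suc i)) \<le> 0"
    using pivot
  proof
    assume st: "start_pivot (Suc i) e p"
    obtain u where "0 \<le> u" "u \<le> 1" "y (Suc i) = (1 - u) *\<^sub>R p + u *\<^sub>R s (Suc i)"
      using c' unfolding in_segment by blast
    then have "0 \<le> e \<bullet> y (Suc i)"
      using c' st transversal_orthogonal[of v e] by (simp add: inner_add_right start_pivot_def)
    then show ?thesis
      using obtuse_at_start[of v e "y (Suc i)"] c' side st iterate_v_pos[of "Suc i"] new_atom_nonpos[of "Suc i"]
      by (simp add: start_pivot_def)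
  next
    assume "tangent_pivot e p"
    then show ?thesis
      using obtuse_at_tangent_pivot[OF _ nonzero inner_self_pos[of "Suc i"] iterate_v_pos _ _ new_atom_nonpos hull,
          of e "s (Suc i)"] c' side
      by (simp add: tangent_pivot_def)
  qed
  then show "chord (Suc i) e p"
    using c' side pivot by (intro chordI) (auto simp: C_Suc)
  show "start_pivot (Suc i) e p \<Longrightarrow> start_pivot (Suc (Suc i)) e p"
    using side by (simp add: start_pivot_def C_Suc[of "Suc i"])
qed

text \<open>
  The newest atom becomes the pivot. It minimizes \<open>y\<^sub>i\<close> over \<open>S\<close>,
  and this is its line of support.
\<close>

lemma chord_opposite_side:
  assumes c: "chord i e p" and side: "e \<bullet> s (Suc (Suc i)) < 0"
  shows "chord (Suc i) (- e) (s (Suc i))" "tangent_pivot (- e) (s (Suc i))"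
proof -
  note c' = c[unfolded chord_def]
  show t: "tangent_pivot (- e) (s (Suc i))"
    using c' iterate_v_pos[of i] new_atom_minimal[of _ i] by (auto simp: tangent_pivot_def)
  have hull: "0 \<notin> convex hull {v, s (Suc i), s (Suc (Suc i))}"
  proof -
    have "convex hull {v, s (Suc i), s (Suc (Suc i))} \<subseteq> convex hull (C (Suc (Suc i)))"
      using c' v_in_C by (intro hull_mono) (auto simp: C_Suc)
    then show ?thesis using zero_notin_hull by blast
  qed
  have "s (Suc i) \<bullet> s (Suc (Suc i)) \<le> 0"
    using obtuse_at_tangent_pivot[OF _ nonzero inner_self_pos[of "Suc i"] iterate_v_pos _ _ new_atom_nonpos hull,
        of "- e" p] c' side transversal_uminus
    by (simp add: inner_commute)
  then show "chord (Suc i) (- e) (s (Suc i))"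
    using c' side t transversal_uminus by (intro chordI) (auto simp: C_Suc)
qed

end

section \<open>Decay of the weight\<close>

context nonvanishing_run
begin

text \<open>
  The line through \<open>y\<^sub>i\<close> perpendicular to \<open>y\<^sub>i\<close> meets the axis
  in \<open>level i\<close> times \<open>v\<close>, and it is reached from \<open>x\<close> by
  adding \<open>gap i x\<close> times \<open>v\<close>.
\<close>

definition level :: "nat \<Rightarrow> real" where
  "level i = (y i \<bullet> y i) / (y i \<bullet> v)"

definition gap :: "nat \<Rightarrow> real^2 \<Rightarrow> real" where
  "gap i x = (y i \<bullet> y i - y i \<bullet> x) / (y i \<bullet> v)"

definition width :: "nat \<Rightarrow> real^2 \<Rightarrow> real^2 \<Rightarrow> real" where
  "width i e p = e \<bullet> s (Suc i) - e \<bullet> p"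

text \<open>
  The product of the two quantities that, up to constants, bound
  \<open>\<parallel>y\<^bsub>i+1\<^esub>\<parallel>\<^sup>2\<close>. In a change of side only the
  level drops reliably, and only over two consecutive steps; hence two consecutive levels.
\<close>

definition weight :: "nat \<Rightarrow> real^2 \<Rightarrow> real^2 \<Rightarrow> real" where
  "weight i e p = (level i * level (Suc i)) * (gap i (s (Suc i)) * width i e p)"

lemma level_pos: "0 < level i"
  using inner_self_pos iterate_v_pos by (simp add: level_def)

text \<open>
  The new atom lies at least as deep below the line as \<open>0\<close> does, because \<open>0 \<in>
  S\<close>.
\<close>

lemma level_le_gap: "level i \<le> gap i (s (Suc i))"
  using new_atom_nonpos[of i] iterate_v_pos[of i]
  by (simp add: level_def gap_def divide_right_mono)

lemma chord_width_pos: "chord i e p \<Longrightarrow> 0 < width i e p"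
  by (simp add: chord_def width_def)

text \<open>
  Turning the line around \<open>p\<close> until it passes through the new atom changes its slope by
  \<open>\<mu> = D/L\<close>. This gives the new level. It also bounds the new gaps:
  \<open>S\<close> lies above the parallel to the old line through the new atom, which falls below
  the new line by \<open>\<mu>\<close> times the horizontal distance from that atom, counted
  positively towards the pivot.
\<close>

lemma chord_level_gap:
  assumes c: "chord i e p"
  shows "level (Suc i) * width i e p = level i * width i e p + gap i (s (Suc i)) * (e \<bullet> p)"
    and "x \<in> S \<Longrightarrow> gap (Suc i) x * width i e p \<le> gap i (s (Suc i)) * (e \<bullet> s (Suc i) - e \<bullet> x)"
proof -
  note c' = c[unfolded chord_def]
  define n where "n = y i /\<^sub>R (y i \<bullet> v)"
  define m where "m = y (Suc i) /\<^sub>R (y (Suc i) \<bullet> v)"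
  have yv: "0 < y i \<bullet> v" "0 < y (Suc i) \<bullet> v" using iterate_v_pos by auto
  then have "n \<bullet> v = m \<bullet> v" by (simp add: n_def m_def)
  then obtain \<mu> where \<mu>: "\<And>x. m \<bullet> x = n \<bullet> x + \<mu> * (e \<bullet> x)"
    using normal_shift c' nonzero by metis
  have gn: "gap i x = level i - n \<bullet> x" for x
    using yv by (simp add: gap_def level_def n_def field_simps)
  have gm: "gap (Suc i) x = level (Suc i) - m \<bullet> x" for x
    using yv by (simp add: gap_def level_def m_def field_simps)
  have np: "n \<bullet> p = level i" using c' by (simp add: n_def level_def field_simps)
  have mp: "m \<bullet> p = level (Suc i)" using c' by (simp add: m_def level_def field_simps)
  have ms: "m \<bullet> s (Suc i) = level (Suc i)" using c' by (simp add: m_def level_def field_simps)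
  let ?D = "gap i (s (Suc i))"
  have D: "\<mu> * width i e p = ?D"
    using \<mu>[of p] \<mu>[of "s (Suc i)"] np mp ms gn[of "s (Suc i)"] by (simp add: width_def algebra_simps)
  have lev: "level (Suc i) = level i + \<mu> * (e \<bullet> p)" using \<mu>[of p] np mp by simp
  show "level (Suc i) * width i e p = level i * width i e p + ?D * (e \<bullet> p)"
    unfolding lev D[symmetric] by (simp add: algebra_simps)
  assume x: "x \<in> S"
  have "n \<bullet> s (Suc i) \<le> n \<bullet> x"
    using new_atom_minimal[OF x, of i] yv by (simp add: n_def mult_left_mono)
  then have "gap (Suc i) x \<le> \<mu> * (e \<bullet> s (Suc i) - e \<bullet> x)"
    using gm[of x] \<mu>[of x] \<mu>[of "s (Suc i)"] ms by (simp add: algebra_simps)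
  then have "gap (Suc i) x * width i e p \<le> \<mu> * (e \<bullet> s (Suc i) - e \<bullet> x) * width i e p"
    using chord_width_pos[OF c] by (intro mult_right_mono) auto
  then show "gap (Suc i) x * width i e p \<le> ?D * (e \<bullet> s (Suc i) - e \<bullet> x)"
    unfolding D[symmetric] by (simp add: algebra_simps)
qed

lemma chord_level_contracts:
  assumes c: "chord i e p"
  shows "level (Suc i) * width i e p \<le> level i * (e \<bullet> s (Suc i))"
    and "level (Suc i) \<le> level i"
proof -
  have ep: "e \<bullet> p \<le> 0" using c by (simp add: chord_def)
  then have "gap i (s (Suc i)) * (e \<bullet> p) \<le> level i * (e \<bullet> p)"
    using level_le_gap[of i] by (rule mult_right_mono_neg[rotated])
  then show 1: "level (Suc i) * width i e p \<le> level i * (e \<bullet> s (Suc i))"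
    using chord_level_gap(1)[OF c] by (simp add: width_def algebra_simps)
  have "level i * (e \<bullet> s (Suc i)) \<le> level i * width i e p"
    using ep level_pos[of i] by (simp add: width_def)
  with 1 show "level (Suc i) \<le> level i"
    using chord_width_pos[OF c] by (meson mult_right_le_imp_le order_trans)
qed

lemma norm_iterate_le_weight:
  assumes c: "chord i e p"
  shows "norm (y (Suc i)) ^ 4 \<le> (v \<bullet> v) * weight i e p"
proof -
  note c' = c[unfolded chord_def]
  define z where "z = y (Suc i)"
  define l where "l = level (Suc i)"
  define L where "L = width i e p"
  have l: "0 < l" "l \<le> level i" using level_pos chord_level_contracts(2)[OF c] by (auto simp: l_def)
  have L: "0 < L" using chord_width_pos[OF c] by (simp add: L_def)
  have zv: "0 < z \<bullet> v" "l * (z \<bullet> v) = z \<bullet> z" using iterate_v_pos[of "Suc i"] by (auto simp: z_def l_def level_def)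
  have Z: "0 < z \<bullet> z" using inner_self_pos by (simp add: z_def)
  have "(z \<bullet> z)\<^sup>2 = l\<^sup>2 * (z \<bullet> v)\<^sup>2" by (simp only: zv(2)[symmetric] power_mult_distrib)
  also have "\<dots> \<le> l\<^sup>2 * ((z \<bullet> z) * (v \<bullet> v))"
    by (intro mult_left_mono Cauchy_Schwarz_ineq) auto
  finally have lv: "z \<bullet> z \<le> l\<^sup>2 * (v \<bullet> v)" using Z by (simp add: power2_eq_square)
  have wid: "(v \<bullet> v) * (z \<bullet> z) \<le> L\<^sup>2"
    unfolding L_def width_def z_def
    by (rule foot_width) (use c' nonzero iterate_v_pos[of "Suc i"] in blast)+
  have "(z \<bullet> z)\<^sup>2 \<le> l\<^sup>2 * ((v \<bullet> v) * (z \<bullet> z))"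
    using mult_right_mono[OF lv less_imp_le[OF Z]] by (simp only: power2_eq_square mult.assoc)
  also have "\<dots> \<le> l\<^sup>2 * L\<^sup>2" by (rule mult_left_mono[OF wid]) simp
  finally have "(z \<bullet> z)\<^sup>2 \<le> (l * L)\<^sup>2" by (simp only: power_mult_distrib)
  then have zL: "z \<bullet> z \<le> l * L" by (rule power2_le_imp_le) (use l L in simp)
  also have "\<dots> \<le> gap i (s (Suc i)) * L"
    using l L level_le_gap[of i] by (intro mult_right_mono) auto
  finally have a: "z \<bullet> z \<le> gap i (s (Suc i)) * L" .
  have "z \<bullet> z \<le> (l * l) * (v \<bullet> v)" using lv by (simp add: power2_eq_square)
  also have "\<dots> \<le> (level i * l) * (v \<bullet> v)" using l by (intro mult_right_mono) auto
  finally have b: "z \<bullet> z \<le> (level i * l) * (v \<bullet> v)" .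
  have "norm z ^ 4 = (z \<bullet> z) * (z \<bullet> z)" 
    unfolding dot_square_norm by (simp flip: power_add)
  also have "\<dots> \<le> ((level i * l) * (v \<bullet> v)) * (gap i (s (Suc i)) * L)"
    using b a by (rule mult_mono) (use order_trans[OF less_imp_le[OF Z] b] Z in auto)
  finally show ?thesis by (simp add: weight_def z_def l_def L_def mult_ac)
qed

text \<open>
  The new atom lies between the axis and the previous one, so \<open>D' \<le> D (L - L')/L\<close>.
  Then \<open>D' L' \<le> D (L - L') L'/L \<le> D L/4\<close>, and the levels do not increase.
\<close>

lemma weight_same_side:
  assumes c: "chord i e p" and c2: "chord (Suc i) e p"
  shows "weight (Suc i) e p \<le> weight i e p / 4"
proof -
  define D D' L L' where "D = gap i (s (Suc i))" and "D' = gap (Suc i) (s (Suc (Suc i)))"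
    and "L = width i e p" and "L' = width (Suc i) e p"
  have pos: "0 < L" "0 < L'" "0 < D" "0 < D'"
    using chord_width_pos c c2 level_pos level_le_gap less_le_trans
    unfolding D_def D'_def L_def L'_def by blast+
  have "D' * L \<le> D * (e \<bullet> s (Suc i) - e \<bullet> s (Suc (Suc i)))"
    unfolding D_def D'_def L_def by (rule chord_level_gap(2)[OF c new_atom_mem])
  then have "D' * L \<le> D * (L - L')" by (simp add: L_def L'_def width_def)
  then have "(D' * L') * L \<le> D * ((L - L') * L')" using pos by (simp add: mult.assoc mult.left_commute mult_left_mono)
  also have "(L - L') * L' \<le> L * L / 4"
    using zero_le_square[of "L - 2 * L'"] by (simp add: algebra_simps)
  finally have "(D' * L') * L \<le> (D * L / 4) * L" using pos by (simp add: mult.assoc)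
  then have DL: "D' * L' \<le> D * L / 4" using pos by (rule_tac mult_right_le_imp_le)
  have "level (Suc (Suc i)) \<le> level i"
    using chord_level_contracts(2)[OF c] chord_level_contracts(2)[OF c2] by simp
  then have "level (Suc i) * level (Suc (Suc i)) \<le> level i * level (Suc i)"
    using level_pos[of "Suc i"] by (simp add: mult.commute)
  then have "weight (Suc i) e p \<le> (level i * level (Suc i)) * (D * L / 4)"
    unfolding weight_def D'_def[symmetric] L'_def[symmetric]
    by (rule mult_mono) (use DL pos level_pos in \<open>auto simp: less_imp_le\<close>)
  then show ?thesis by (simp add: weight_def D_def L_def)
qed

text \<open>
  The chord ends at an atom, so it runs above the line of support at \<open>p\<close> on the side of
  that atom and below it farther out. Points of \<open>S\<close> farther out than \<open>p\<close>
  are therefore not below the chord, but the new atom is.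
\<close>

lemma tangent_pivot_bounds_new_atom:
  assumes c: "chord i e p" and t: "tangent_pivot e p"
  shows "e \<bullet> p < e \<bullet> s (Suc (Suc i))"
proof -
  note c' = c[unfolded chord_def]
  obtain h where h: "0 < h \<bullet> v" "\<And>x. x \<in> S \<Longrightarrow> h \<bullet> p \<le> h \<bullet> x"
    using t unfolding tangent_pivot_def by blast
  define n where "n = y (Suc i) /\<^sub>R (y (Suc i) \<bullet> v)"
  define k where "k = h /\<^sub>R (h \<bullet> v)"
  have yv: "0 < y (Suc i) \<bullet> v" by (rule iterate_v_pos)
  have "n \<bullet> v = k \<bullet> v" using yv h by (simp add: n_def k_def)
  then obtain \<nu> where \<nu>: "\<And>x. k \<bullet> x = n \<bullet> x + \<nu> * (e \<bullet> x)"
    using normal_shift c' nonzero by metis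
  have kmin: "k \<bullet> p \<le> k \<bullet> s (Suc j)" for j
    using h(2)[OF new_atom_mem] h(1) by (simp add: k_def mult_left_mono)
  have "n \<bullet> p = n \<bullet> s (Suc i)" using c' by (simp add: n_def)
  then have "0 \<le> \<nu> * (e \<bullet> s (Suc i) - e \<bullet> p)"
    using kmin[of i] \<nu>[of p] \<nu>[of "s (Suc i)"] by (simp add: algebra_simps)
  then have \<nu>0: "0 \<le> \<nu>" using c' by (simp add: zero_le_mult_iff)
  have "n \<bullet> s (Suc (Suc i)) \<le> 0" using new_atom_nonpos[of "Suc i"] yv
    by (simp add: n_def mult_nonneg_nonpos divide_nonpos_pos)
  moreover have "0 < n \<bullet> p" using c' inner_self_pos[of "Suc i"] yv by (simp add: n_def)
  ultimately have "0 < \<nu> * (e \<bullet> s (Suc (Suc i)) - e \<bullet> p)"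
    using kmin[of "Suc i"] \<nu>[of p] \<nu>[of "s (Suc (Suc i))"] by (simp add: algebra_simps)
  then show ?thesis using \<nu>0 by (simp add: zero_less_mult_iff)
qed

text \<open>
  With \<open>a\<close> and \<open>b\<close> the distances of the previous atom and of the pivot
  from the axis, and \<open>b'\<close> that of the new atom, the two levels shrink by
  \<open>a/(a+b)\<close> and \<open>b'/(a+b')\<close>. Since \<open>b' \<le> b\<close>, the product
  is at most \<open>a b'/(a+b')\<^sup>2 \<le> 1/4\<close>. Neither the gap nor the width increases.
\<close>

lemma weight_opposite_side:
  assumes c: "chord i e p" and t: "tangent_pivot e p"
    and c2: "chord (Suc i) (- e) (s (Suc i))"
  shows "weight (Suc i) (- e) (s (Suc i)) \<le> weight i e p / 4"
proof -
  define D D' L L' where "D = gap i (s (Suc i))" and "D' = gap (Suc i) (s (Suc (Suc i)))"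
    and "L = width i e p" and "L' = width (Suc i) (- e) (s (Suc i))"
  define a b b' where "a = e \<bullet> s (Suc i)" and "b = - (e \<bullet> p)" and "b' = - (e \<bullet> s (Suc (Suc i)))"
  have pos: "0 < L" "0 < L'" "0 < D" "0 < D'"
    using chord_width_pos c c2 level_pos level_le_gap less_le_trans
    unfolding D_def D'_def L_def L'_def by blast+
  have LL: "L = a + b" "L' = a + b'" by (simp_all add: L_def L'_def a_def b_def b'_def width_def)
  have ab: "0 < a" "0 < b'" using c c2 by (simp_all add: chord_def a_def b'_def)
  have bb: "b' \<le> b" using tangent_pivot_bounds_new_atom[OF c t] by (simp add: b_def b'_def)
  have "D' * L \<le> D * L'"
    using chord_level_gap(2)[OF c new_atom_mem[of "Suc i"]] LL
    by (simp add: D_def D'_def L_def a_def b'_def)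
  also have "\<dots> \<le> D * L" using bb LL pos by simp
  finally have "D' \<le> D" using pos by simp
  then have DL: "D' * L' \<le> D * L" using bb LL pos by (intro mult_mono) auto
  let ?c = "level i" and ?c' = "level (Suc i)" and ?c'' = "level (Suc (Suc i))"
  have 1: "?c' * L \<le> ?c * a" using chord_level_contracts(1)[OF c] by (simp add: L_def a_def)
  have 2: "?c'' * L' \<le> ?c' * b'" using chord_level_contracts(1)[OF c2] by (simp add: L'_def b'_def)
  have "4 * (a * b') \<le> L' * L'"
    using zero_le_square[of "a - b'"] by (simp add: LL algebra_simps)
  also have "\<dots> \<le> L * L'" using bb LL pos by simp
  finally have amgm: "4 * (a * b') \<le> L * L'" .
  have "(4 * ?c'') * (L * L') = 4 * L * (?c'' * L')" by simp
  also have "\<dots> \<le> 4 * L * (?c' * b')" using 2 pos by (intro mult_left_mono) auto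
  also have "\<dots> = 4 * b' * (?c' * L)" by simp
  also have "\<dots> \<le> 4 * b' * (?c * a)" using 1 ab by (intro mult_left_mono) auto
  also have "\<dots> = ?c * (4 * (a * b'))" by simp
  also have "\<dots> \<le> ?c * (L * L')" using amgm level_pos[of i] by (intro mult_left_mono) auto
  finally have "4 * ?c'' \<le> ?c" using pos by (simp add: mult_le_cancel_right)
  then have "?c' * ?c'' \<le> ?c * ?c' / 4"
    using mult_left_mono[of "4 * ?c''" ?c ?c'] level_pos[of "Suc i"] by (simp add: mult_ac)
  then have "weight (Suc i) (- e) (s (Suc i)) \<le> (?c * ?c' / 4) * (D * L)"
    unfolding weight_def D'_def[symmetric] L'_def[symmetric]
    by (rule mult_mono) (use DL pos level_pos in \<open>auto simp: less_imp_le\<close>)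
  then show ?thesis by (simp add: weight_def D_def L_def)
qed

lemma chord_tangent_step:
  assumes c: "chord i e p" and t: "tangent_pivot e p"
  obtains e' p' where "chord (Suc i) e' p'" "tangent_pivot e' p'"
    "weight (Suc i) e' p' \<le> weight i e p / 4"
proof (cases "0 < e \<bullet> s (Suc (Suc i))")
  case True
  then show thesis using that chord_same_side(1)[OF c] weight_same_side[OF c] t by blast
next
  case False
  then have "e \<bullet> s (Suc (Suc i)) < 0"
    using new_atom_off_axis[of e "Suc i"] c by (simp add: chord_def less_le)
  then show thesis using that chord_opposite_side[OF c] weight_opposite_side[OF c t] by blast
qed

lemma chord_tangent_tail:
  assumes c: "chord i e p" "tangent_pivot e p"
  shows "\<exists>e' p'. chord (i + k) e' p' \<and> tangent_pivot e' p' \<and> weight (i + k) e' p' \<le> weight i e p / 4 ^ k"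
proof (induction k)
  case 0
  then show ?case using c by auto
next
  case (Suc k)
  then obtain e' p' where h: "chord (i + k) e' p'" "tangent_pivot e' p'"
    "weight (i + k) e' p' \<le> weight i e p / 4 ^ k" by blast
  obtain e'' p'' where "chord (Suc (i + k)) e'' p''" "tangent_pivot e'' p''"
    "weight (Suc (i + k)) e'' p'' \<le> weight (i + k) e' p' / 4"
    using chord_tangent_step[OF h(1,2)] .
  moreover from this(3) have "weight (Suc (i + k)) e'' p'' \<le> weight i e p / 4 ^ Suc k"
    using h(3) by simp
  ultimately show ?case by auto
qed

text \<open>
  A change of side makes an atom with a line of support the pivot. Without any change of side the
  pivot stays \<open>v\<close>, and every step is a Newton step.
\<close>

lemma one_sided_or_tangent:
  assumes c: "chord 0 e v" "start_pivot (Suc 0) e v"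
  shows "(\<forall>i. chord i e v \<and> weight i e v \<le> weight 0 e v / 4 ^ i)
    \<or> (\<exists>i e' p'. chord i e' p' \<and> tangent_pivot e' p')"
proof (rule disjCI)
  assume no: "\<not> (\<exists>i e' p'. chord i e' p' \<and> tangent_pivot e' p')"
  have "chord i e v \<and> start_pivot (Suc i) e v \<and> weight i e v \<le> weight 0 e v / 4 ^ i" for i
  proof (induction i)
    case 0
    then show ?case using c by simp
  next
    case (Suc i)
    then have h: "chord i e v" "start_pivot (Suc i) e v" "weight i e v \<le> weight 0 e v / 4 ^ i" by auto
    have "0 < e \<bullet> s (Suc (Suc i))"
    proof (rule ccontr)
      assume "\<not> 0 < e \<bullet> s (Suc (Suc i))"
      then have "e \<bullet> s (Suc (Suc i)) < 0"
        using new_atom_off_axis[of e "Suc i"] h(1) by (simp add: chord_def less_le)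
      then show False using chord_opposite_side[OF h(1)] no by blast
    qed
    then have "chord (Suc i) e v" "start_pivot (Suc (Suc i)) e v"
      using chord_same_side[OF h(1)] h(2) by blast+
    moreover have "weight (Suc i) e v \<le> weight 0 e v / 4 ^ Suc i"
      using weight_same_side[OF h(1) calculation(1)] h(3) by simp
    ultimately show ?case by blast
  qed
  then show "\<forall>i. chord i e v \<and> weight i e v \<le> weight 0 e v / 4 ^ i" by blast
qed

lemma weight_decay:
  "\<exists>J B. \<forall>k. \<exists>e p. chord (J + k) e p \<and> weight (J + k) e p \<le> B / 4 ^ k"
proof -
  obtain e where e: "chord 0 e v" "start_pivot (Suc 0) e v" by (rule chord_first)
  show ?thesis
    using one_sided_or_tangent[OF e]
  proof (elim disjE exE conjE)
    assume "\<forall>i. chord i e v \<and> weight i e v \<le> weight 0 e v / 4 ^ i"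
    then have "\<forall>k. \<exists>e' p'. chord (0 + k) e' p' \<and> weight (0 + k) e' p' \<le> weight 0 e v / 4 ^ k"
      unfolding add_0 by blast
    then show ?thesis by (intro exI)
  next
    fix i e' p' assume "chord i e' p'" "tangent_pivot e' p'"
    then have "\<forall>k. \<exists>e p. chord (i + k) e p \<and> weight (i + k) e p \<le> weight i e' p' / 4 ^ k"
      using chord_tangent_tail by blast
    then show ?thesis by (intro exI)
  qed
qed

lemma eventual_fourth_power_bound:
  "\<exists>J B. 0 \<le> B \<and> (\<forall>k. norm (y (Suc (J + k))) ^ 4 \<le> B / 4 ^ k)"
proof -
  obtain J B where B: "\<And>k. \<exists>e p. chord (J + k) e p \<and> weight (J + k) e p \<le> B / 4 ^ k"
    using weight_decay by blast
  have bound: "norm (y (Suc (J + k))) ^ 4 \<le> (v \<bullet> v) * B / 4 ^ k" for k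
  proof -
    obtain e p where h: "chord (J + k) e p" "weight (J + k) e p \<le> B / 4 ^ k" using B by blast
    have "norm (y (Suc (J + k))) ^ 4 \<le> (v \<bullet> v) * weight (J + k) e p"
      by (rule norm_iterate_le_weight[OF h(1)])
    also have "\<dots> \<le> (v \<bullet> v) * (B / 4 ^ k)" by (rule mult_left_mono[OF h(2)]) simp
    finally show ?thesis by simp
  qed
  have "0 \<le> norm (y (Suc (J + 0))) ^ 4" by simp
  also have "\<dots> \<le> (v \<bullet> v) * B" using bound[of 0] by simp
  finally show ?thesis using bound by blast
qed

end

section \<open>Linear convergence\<close>

text \<open>
  Finitely many initial terms only affect the constant.
\<close>

lemma linear_bound_if_eventual:
  fixes f :: "nat \<Rightarrow> real"
  assumes "0 < r" "0 \<le> B" and f: "\<And>i. 0 \<le> f i" and tail: "\<And>k. f (J + k) \<le> B * r ^ k"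
  shows "\<exists>M\<ge>0. \<forall>i. f i \<le> M * r ^ i"
proof (intro exI conjI allI)
  define M where "M = B / r ^ J + (\<Sum>i<J. f i / r ^ i)"
  have n: "0 \<le> B / r ^ J" "0 \<le> (\<Sum>i<J. f i / r ^ i)"
    using assms by (auto intro!: sum_nonneg)
  then show "0 \<le> M" by (simp add: M_def)
  fix i
  have "f i / r ^ i \<le> M"
  proof (cases "i < J")
    case True
    have "f i / r ^ i \<le> (\<Sum>i<J. f i / r ^ i)"
      using True assms by (intro member_le_sum) auto
    then show ?thesis using n by (simp add: M_def)
  next
    case False
    then obtain k where k: "i = J + k" using le_Suc_ex not_less by blast
    then have "f i / r ^ i \<le> B / r ^ J"
      using tail[of k] assms(1) by (simp add: power_add field_simps)
    then show ?thesis using n by (simp add: M_def)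
  qed
  then show "f i \<le> M * r ^ i" using assms(1) by (simp add: field_simps)
qed

theorem theorem3p6:
  fixes S :: "(real^2) set" and y s :: "nat \<Rightarrow> real^2" and N :: enat
  assumes "compact S" and "convex S" and "0 \<in> frontier S"
    and "generated_by_algorithm S y s N"
  shows "\<exists>M\<ge>0. \<forall>i. enat i \<le> N \<longrightarrow> norm (y i) \<le> M * (1 / sqrt 2) ^ i"
proof -
  have closed: "closed S" using assms(1) by (rule compact_imp_closed)
  have zero: "0 \<in> S" and start: "y 0 \<in> S"
    using closed assms(3,4) by (auto simp: frontier_def generated_by_algorithm_def)
  have iter: "iteration S y s i" if "enat i < N" for i
    using assms(4) that by (auto simp: generated_by_algorithm_def)
  show ?thesis
  proof (cases "\<exists>n. enat n \<le> N \<and> y n = 0")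
    case True
    then obtain n where n: "enat n \<le> N" "y n = 0" by blast
    have vanish: "y (n + k) = 0" if "enat (n + k) \<le> N" for k
      using that
    proof (cases k)
      case (Suc j)
      let ?H = "convex hull (atoms (y 0) s (n + k))"
      have step: "y (Suc i) = closest_point (convex hull (atoms (y 0) s (Suc i))) 0" if "enat (Suc i) \<le> N" for i
        using iter[of i] that by (simp add: iteration_def Suc_ile_eq)
      have cl: "closed (convex hull (atoms (y 0) s i))" "convex hull (atoms (y 0) s i) \<noteq> {}" for i
        by (auto simp: atoms_def finite_imp_compact_convex_hull compact_imp_closed)
      have "0 \<in> convex hull (atoms (y 0) s n)"
      proof (cases n)
        case 0
        then show ?thesis using n by (auto simp: atoms_def intro: hull_inc)
      next
        case (Suc i)
        then show ?thesis using step[of i] n closest_point_in_set[OF cl, of "Suc i" 0] by simp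
      qed
      moreover have "convex hull (atoms (y 0) s n) \<subseteq> ?H"
        by (intro hull_mono) (auto simp: atoms_def)
      ultimately have "0 \<in> ?H" by blast
      then show ?thesis using step[of "n + j"] that Suc closest_point_self[of 0 ?H] by simp
    qed (use n in simp)
    \<comment> \<open>Beyond \<open>N\<close> the values of \<open>y\<close> are arbitrary and are replaced by \<open>0\<close>.\<close>
    let ?f = "\<lambda>i. if enat i \<le> N then norm (y i) else 0"
    have "\<exists>M\<ge>0. \<forall>i. ?f i \<le> M * (1 / sqrt 2) ^ i"
      by (rule linear_bound_if_eventual[where B = 0 and J = n]) (use vanish in auto)
    then show ?thesis by (metis (full_types))
  next
    case False
    then have N: "N = \<infinity>" using assms(4) by (auto simp: generated_by_algorithm_def)
    interpret nonvanishing_run S y s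
      by unfold_locales (use zero start iter N False in auto)
    obtain J B where B: "0 \<le> B" "\<And>k. norm (y (Suc (J + k))) ^ 4 \<le> B / 4 ^ k"
      using eventual_fourth_power_bound by blast
    have r4: "(1 / sqrt 2) ^ 4 = (1 / 4 :: real)"
      by (simp add: power_divide power4_eq_xxxx)
    have "norm (y (Suc J + k)) \<le> root 4 B * (1 / sqrt 2) ^ k" for k
    proof (rule power_le_imp_le_base)
      have "(root 4 B * (1 / sqrt 2) ^ k) ^ Suc 3 = root 4 B ^ 4 * ((1 / sqrt 2) ^ 4) ^ k"
        by (simp add: power_mult_distrib power_mult[symmetric] mult.commute)
      also have "\<dots> = B / 4 ^ k" unfolding r4 using B(1) by (simp add: power_one_over field_simps)
      finally show "norm (y (Suc J + k)) ^ Suc 3 \<le> (root 4 B * (1 / sqrt 2) ^ k) ^ Suc 3"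
        using B(2)[of k] by simp
    qed (use B(1) in auto)
    then have "\<exists>M\<ge>0. \<forall>i. norm (y i) \<le> M * (1 / sqrt 2) ^ i"
      using B(1) by (intro linear_bound_if_eventual[where J = "Suc J" and B = "root 4 B"]) auto
    then show ?thesis by blast
  qed
qed

end
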